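(* Let $u$ be an RGA term. If $\emptyset\vdash\neg(\mathcal A\cdot u)$ is derivable in RGA, then $\emptyset\vdash\neg(u\cdot\underline n)$ is derivable in RGA for some $n\in\mathbb N$.
   Context: **Terms.** Raw terms are: variables $v_i$ ($i\in\mathbb N$, de Bruijn indices), and operator nodes, each consisting of an operator code, a binder count $k\in\mathbb N$ and a finite list of raw terms as arguments, in each of which the $k$ lowest indices are bound. RGA has ten operators: constants $\bot$, $\mathbf 0$, $\mathcal R$ (recursor), $\mathcal A$ (universal quantifier combinator); unary $\mathbf S$, $\neg$; unary $\lambda$ (binder count 1, the only binder); binary $=$, $\lor$, and application $\cdot$ (left associative). A term $t$ is well-formed, $\mathrm{wf}(t)$, iff it is built from variables and these ten operators at these arities and binder counts. "Term" means raw term; formulas are just terms. Closed means having no free variables. $\underline n=\mathbf S^n\mathbf 0$ is the numeral of $n$. $[v_i\mapsto s]t$ (also $[i\mapsto s]t$): capture-avoiding replacement of the free variable $v_i$ by $s$, other free variables unchanged. $b[t]$: $\beta$-instance, replacing index $0$ in $b$ by $t$ and decrementing all other free indices. $\uparrow t$: all free indices increased by one; $\uparrow\Gamma$ elementwise. $\mathrm{fv}$: set of free variables. Abbreviations: $t\neq u:=\neg(t=u)$; $t\,\mathsf N:=(t=t)$; $t\,\mathsf B:=(t\lor\neg t)$; $t\land u:=\neg(\neg t\lor\neg u)$. **Head steps** $t\triangleright t'$ (syntactic relation): $(\lambda b)\cdot t\triangleright b[t]$ if $\mathrm{wf}(t)$; $\mathcal R\cdot g\cdot h\cdot\mathbf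 0\triangleright g$ if $\mathrm{wf}(h)$; $\mathcal R\cdot g\cdot h\cdot(\mathbf S\,\underline n)\triangleright h\cdot\underline n\cdot(\mathcal R\cdot g\cdot h\cdot\underline n)$ if $\mathrm{wf}(g)$; and $t\cdot u\triangleright t'\cdot u$ if $t\triangleright t'$. **Proofs.** A judgment $\Gamma\vdash c$ has a finite set $\Gamma$ of terms and a term $c$. A proof is a finite list of judgments each following from earlier entries by one rule below; a judgment is derivable if some proof contains it. Writing $\Gamma\vdash c$ as an assertion means derivability. Rules ($\Rightarrow$ from premises to conclusion, $\Leftrightarrow$ both directions): Structural: $\mathrm{wf}(c)\Rightarrow\Gamma,c\vdash c$; $\Gamma\vdash c\Rightarrow\Gamma,a\vdash c$; $\Gamma\vdash a$ and $\Gamma,a\vdash c\Rightarrow\Gamma\vdash c$; $\Gamma\vdash c$ with $\Gamma,c,s$ well-formed $\Rightarrow[v\mapsto s]\Gamma\vdash[v\mapsto s]c$. Truth values: $\Gamma\vdash a\Leftrightarrow\Gamma\vdash a=\underline 1$; $\Gamma\vdash\neg a\Leftrightarrow\Gamma\vdash a=\underline 0$. Negation: $\Gamma\vdash\neg a$, $\Gamma\vdash a$, $\mathrm{wf}(c)\Rightarrow\Gamma\vdash c$; $\Gamma\vdash a\Leftrightarrow\Gamma\vdash\neg\neg a$. Disjunction: $\Gamma\vdash a$, $\mathrm{wf}(b)\Rightarrow\Gamma\vdash a\lor b$; $\Gamma\vdash b$, $\mathrm{wf}(a)\Rightarrow\Gamma\vdash a\lor b$; $\Gamma\vdash\neg a$,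 $\Gamma\vdash\neg b\Rightarrow\Gamma\vdash\neg(a\lor b)$; $\Gamma\vdash a\lor b$, $\Gamma,a\vdash c$, $\Gamma,b\vdash c\Rightarrow\Gamma\vdash c$; $\Gamma\vdash\neg(a\lor b)\Rightarrow\Gamma\vdash\neg a$, and $\Rightarrow\Gamma\vdash\neg b$. Equality: $\Gamma\vdash a\,\mathsf N\Leftrightarrow\Gamma\vdash a=a$; $\Gamma\vdash a=b\Rightarrow\Gamma\vdash b=a$; $\Gamma\vdash a=b$, $\Gamma\vdash[v\mapsto a]p$, $\mathrm{wf}(p)\Rightarrow\Gamma\vdash[v\mapsto b]p$; $\Gamma\vdash a\ne b\Rightarrow\Gamma\vdash b\ne a$; $\Gamma\vdash a\,\mathsf N$, $\Gamma\vdash b\,\mathsf N\Rightarrow\Gamma\vdash(a=b)\,\mathsf B$; $\Gamma\vdash(a=b)\,\mathsf B\Rightarrow\Gamma\vdash(a\,\mathsf N)\land(b\,\mathsf N)$. Naturals: $\Gamma\vdash\mathbf 0\,\mathsf N$; $\Gamma\vdash a\,\mathsf N\Leftrightarrow\Gamma\vdash\mathbf S a\,\mathsf N$; $\Gamma\vdash a\,\mathsf N\Rightarrow\Gamma\vdash\mathbf S a\ne\mathbf 0$; $\Gamma\vdash a\ne b\Leftrightarrow\Gamma\vdash\mathbf S a\ne\mathbf S b$; $\Gamma\vdash\mathbf S a=\mathbf S b\Rightarrow\Gamma\vdash a=b$; $\Gamma\vdash\bot\,\mathsf N$, $\mathrm{wf}(p)\Rightarrow\Gamma\vdash p$. Induction: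 $\Gamma\vdash[i\mapsto\mathbf 0]c$; $v_i\,\mathsf N,c,\Gamma\vdash[i\mapsto\mathbf S v_i]c$; $\Gamma\vdash a\,\mathsf N$; $\mathrm{wf}(c)$; $i\notin\mathrm{fv}(\Gamma)$ $\Rightarrow\Gamma\vdash[i\mapsto a]c$. Conversion: if $c\triangleright c'$: $\Gamma\vdash c'\Leftrightarrow\Gamma\vdash c$; $\Gamma\vdash c'\,\mathsf N\Rightarrow\Gamma\vdash c=c'$. Recursor: $\Gamma\vdash m\,\mathsf N$, $\Gamma\vdash(h\cdot m\cdot(\mathcal R\cdot g\cdot h\cdot m))\,\mathsf N$, $\mathrm{wf}(g)\Rightarrow\Gamma\vdash\mathcal R\cdot g\cdot h\cdot(\mathbf S m)=h\cdot m\cdot(\mathcal R\cdot g\cdot h\cdot m)$. Quantifier: $v_0\,\mathsf N,\uparrow\Gamma\vdash\uparrow f\cdot v_0\Rightarrow\Gamma\vdash\mathcal A\cdot f$; $\Gamma\vdash\mathcal A\cdot f$, $\Gamma\vdash a\,\mathsf N\Rightarrow\Gamma\vdash f\cdot a$; $\Gamma\vdash\neg(f\cdot a)$, $\Gamma\vdash a\,\mathsf N\Rightarrow\Gamma\vdash\neg(\mathcal A\cdot f)$; $\Gamma\vdash\neg(\mathcal A\cdot f)$ and $v_0\,\mathsf N,\neg(\uparrow f\cdot v_0),\uparrow\Gamma\vdash\uparrow c\Rightarrow\Gamma\vdash c$. *)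

theory Defs
  imports Main "HOL-Library.FSet"
begin

section \<open>Raw terms\<close>

(* Raw terms are not restricted to the signature of RGA: Foreign provides operator codes outside
   the ten of RGA, and any code may occur with any binder count and any number of arguments. *)
datatype opcode =
    OBot | OZero | ORec | OAll | OSuc | ONeg | OLam | OEq | OOr | OApp | Foreign nat

datatype trm = Var nat | Node opcode nat "trm list"

(* (binder count, arity) *)
fun sig :: "opcode \<Rightarrow> (nat \<times> nat) option" where
  "sig OBot = Some (0, 0)"
| "sig OZero = Some (0, 0)"
| "sig ORec = Some (0, 0)"
| "sig OAll = Some (0, 0)"
| "sig OSuc = Some (0, 1)"
| "sig ONeg = Some (0, 1)"
| "sig OLam = Some (1, 1)"
| "sig OEq = Some (0, 2)"
| "sig OOr = Some (0, 2)"
| "sig OApp = Some (0, 2)"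
| "sig (Foreign n) = None"

fun wf_trm :: "trm \<Rightarrow> bool" where
  "wf_trm (Var i) \<longleftrightarrow> True"
| "wf_trm (Node f k ts) \<longleftrightarrow> sig f = Some (k, length ts) \<and> (\<forall>t\<in>set ts. wf_trm t)"

abbreviation Bot :: trm where "Bot \<equiv> Node OBot 0 []"
abbreviation Zero :: trm where "Zero \<equiv> Node OZero 0 []"
abbreviation Rec :: trm where "Rec \<equiv> Node ORec 0 []"
abbreviation AllC :: trm where "AllC \<equiv> Node OAll 0 []"
abbreviation S :: "trm \<Rightarrow> trm" where "S t \<equiv> Node OSuc 0 [t]"
abbreviation Neg :: "trm \<Rightarrow> trm" where "Neg t \<equiv> Node ONeg 0 [t]"
abbreviation Lam :: "trm \<Rightarrow> trm" where "Lam b \<equiv> Node OLam 1 [b]"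
abbreviation Eq :: "trm \<Rightarrow> trm \<Rightarrow> trm" (infix "\<doteq>" 60) where "t \<doteq> u \<equiv> Node OEq 0 [t, u]"
abbreviation Or :: "trm \<Rightarrow> trm \<Rightarrow> trm" where "Or t u \<equiv> Node OOr 0 [t, u]"
abbreviation App :: "trm \<Rightarrow> trm \<Rightarrow> trm" (infixl "\<cdot>" 75) where "t \<cdot> u \<equiv> Node OApp 0 [t, u]"

abbreviation Neq :: "trm \<Rightarrow> trm \<Rightarrow> trm" where "Neq t u \<equiv> Neg (t \<doteq> u)"
abbreviation IsNat :: "trm \<Rightarrow> trm" where "IsNat t \<equiv> t \<doteq> t"
abbreviation IsBool :: "trm \<Rightarrow> trm" where "IsBool t \<equiv> Or t (Neg t)"
abbreviation And :: "trm \<Rightarrow> trm \<Rightarrow> trm" where "And t u \<equiv> Neg (Or (Neg t) (Neg u))"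

fun num :: "nat \<Rightarrow> trm" where
  "num 0 = Zero"
| "num (Suc n) = S (num n)"

section \<open>Free variables and substitution\<close>

fun fv :: "trm \<Rightarrow> nat set" where
  "fv (Var i) = {i}"
| "fv (Node f k ts) = (\<Union>t\<in>set ts. {i. i + k \<in> fv t})"

(* Adds d to every index that is at least c. *)
fun shift :: "nat \<Rightarrow> nat \<Rightarrow> trm \<Rightarrow> trm" where
  "shift d c (Var i) = Var (if i < c then i else i + d)"
| "shift d c (Node f k ts) = Node f k (map (shift d (c + k)) ts)"

abbreviation up :: "trm \<Rightarrow> trm" where "up \<equiv> shift 1 0"

(* subst i s t is [v_i |-> s]t: the remaining free indices are not renumbered. *)
fun subst :: "nat \<Rightarrow> trm \<Rightarrow> trm \<Rightarrow> trm" where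
  "subst i s (Var j) = (if j = i then s else Var j)"
| "subst i s (Node f k ts) = Node f k (map (subst (i + k) (shift k 0 s)) ts)"

(* Replaces index d by s and decrements the indices above d. *)
fun inst :: "nat \<Rightarrow> trm \<Rightarrow> trm \<Rightarrow> trm" where
  "inst d s (Var j) = (if j < d then Var j else if j = d then s else Var (j - 1))"
| "inst d s (Node f k ts) = Node f k (map (inst (d + k) (shift k 0 s)) ts)"

abbreviation beta :: "trm \<Rightarrow> trm \<Rightarrow> trm" where "beta b t \<equiv> inst 0 t b"

section \<open>Head steps\<close>

inductive head_step :: "trm \<Rightarrow> trm \<Rightarrow> bool" (infix "\<triangleright>" 50) where
  hs_beta: "wf_trm t \<Longrightarrow> Lam b \<cdot> t \<triangleright> beta b t"
| hs_rec0: "wf_trm h \<Longrightarrow> Rec \<cdot> g \<cdot> h \<cdot> Zero \<triangleright> g"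
| hs_recS: "wf_trm g \<Longrightarrow> Rec \<cdot> g \<cdot> h \<cdot> S (num n) \<triangleright> h \<cdot> num n \<cdot> (Rec \<cdot> g \<cdot> h \<cdot> num n)"
| hs_app: "t \<triangleright> t' \<Longrightarrow> t \<cdot> u \<triangleright> t' \<cdot> u"

section \<open>Proofs\<close>

datatype sequent = Sequent "trm fset" trm (infix "\<turnstile>" 55)

(* follows_from P j: a single rule application yields j from premises in P. *)
inductive follows_from :: "sequent set \<Rightarrow> sequent \<Rightarrow> bool" for P :: "sequent set" where
  \<comment> \<open>structural\<close>
  hyp: "wf_trm c \<Longrightarrow> follows_from P (finsert c G \<turnstile> c)"
| weaken: "G \<turnstile> c \<in> P \<Longrightarrow> follows_from P (finsert a G \<turnstile> c)"
| cut: "G \<turnstile> a \<in> P \<Longrightarrow> finsert a G \<turnstile> c \<in> P \<Longrightarrow> follows_from P (G \<turnstile> c)"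
| substitution: "G \<turnstile> c \<in> P \<Longrightarrow> \<forall>a. a |\<in>| G \<longrightarrow> wf_trm a \<Longrightarrow> wf_trm c \<Longrightarrow> wf_trm s \<Longrightarrow>
    follows_from P (subst v s |`| G \<turnstile> subst v s c)"
  \<comment> \<open>truth values\<close>
| true_I: "G \<turnstile> a \<in> P \<Longrightarrow> follows_from P (G \<turnstile> a \<doteq> num 1)"
| true_E: "G \<turnstile> a \<doteq> num 1 \<in> P \<Longrightarrow> follows_from P (G \<turnstile> a)"
| false_I: "G \<turnstile> Neg a \<in> P \<Longrightarrow> follows_from P (G \<turnstile> a \<doteq> num 0)"
| false_E: "G \<turnstile> a \<doteq> num 0 \<in> P \<Longrightarrow> follows_from P (G \<turnstile> Neg a)"
  \<comment> \<open>negation\<close>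
| neg_E: "G \<turnstile> Neg a \<in> P \<Longrightarrow> G \<turnstile> a \<in> P \<Longrightarrow> wf_trm c \<Longrightarrow> follows_from P (G \<turnstile> c)"
| neg_neg_I: "G \<turnstile> a \<in> P \<Longrightarrow> follows_from P (G \<turnstile> Neg (Neg a))"
| neg_neg_E: "G \<turnstile> Neg (Neg a) \<in> P \<Longrightarrow> follows_from P (G \<turnstile> a)"
  \<comment> \<open>disjunction\<close>
| or_I1: "G \<turnstile> a \<in> P \<Longrightarrow> wf_trm b \<Longrightarrow> follows_from P (G \<turnstile> Or a b)"
| or_I2: "G \<turnstile> b \<in> P \<Longrightarrow> wf_trm a \<Longrightarrow> follows_from P (G \<turnstile> Or a b)"
| neg_or_I: "G \<turnstile> Neg a \<in> P \<Longrightarrow> G \<turnstile> Neg b \<in> P \<Longrightarrow> follows_from P (G \<turnstile> Neg (Or a b))"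
| or_E: "G \<turnstile> Or a b \<in> P \<Longrightarrow> finsert a G \<turnstile> c \<in> P \<Longrightarrow> finsert b G \<turnstile> c \<in> P \<Longrightarrow>
    follows_from P (G \<turnstile> c)"
| neg_or_E1: "G \<turnstile> Neg (Or a b) \<in> P \<Longrightarrow> follows_from P (G \<turnstile> Neg a)"
| neg_or_E2: "G \<turnstile> Neg (Or a b) \<in> P \<Longrightarrow> follows_from P (G \<turnstile> Neg b)"
  \<comment> \<open>equality; the first two rules are identities because \<^const>\<open>IsNat\<close> is an abbreviation\<close>
| nat_E: "G \<turnstile> IsNat a \<in> P \<Longrightarrow> follows_from P (G \<turnstile> a \<doteq> a)"
| nat_I: "G \<turnstile> a \<doteq> a \<in> P \<Longrightarrow> follows_from P (G \<turnstile> IsNat a)"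
| eq_sym: "G \<turnstile> a \<doteq> b \<in> P \<Longrightarrow> follows_from P (G \<turnstile> b \<doteq> a)"
| eq_subst: "G \<turnstile> a \<doteq> b \<in> P \<Longrightarrow> G \<turnstile> subst v a p \<in> P \<Longrightarrow> wf_trm p \<Longrightarrow>
    follows_from P (G \<turnstile> subst v b p)"
| neq_sym: "G \<turnstile> Neq a b \<in> P \<Longrightarrow> follows_from P (G \<turnstile> Neq b a)"
| eq_bool_I: "G \<turnstile> IsNat a \<in> P \<Longrightarrow> G \<turnstile> IsNat b \<in> P \<Longrightarrow> follows_from P (G \<turnstile> IsBool (a \<doteq> b))"
| eq_bool_E: "G \<turnstile> IsBool (a \<doteq> b) \<in> P \<Longrightarrow> follows_from P (G \<turnstile> And (IsNat a) (IsNat b))"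
  \<comment> \<open>naturals\<close>
| zero_nat: "follows_from P (G \<turnstile> IsNat Zero)"
| suc_nat_I: "G \<turnstile> IsNat a \<in> P \<Longrightarrow> follows_from P (G \<turnstile> IsNat (S a))"
| suc_nat_E: "G \<turnstile> IsNat (S a) \<in> P \<Longrightarrow> follows_from P (G \<turnstile> IsNat a)"
| suc_neq_zero: "G \<turnstile> IsNat a \<in> P \<Longrightarrow> follows_from P (G \<turnstile> Neq (S a) Zero)"
| suc_neq_I: "G \<turnstile> Neq a b \<in> P \<Longrightarrow> follows_from P (G \<turnstile> Neq (S a) (S b))"
| suc_neq_E: "G \<turnstile> Neq (S a) (S b) \<in> P \<Longrightarrow> follows_from P (G \<turnstile> Neq a b)"
| suc_inj: "G \<turnstile> S a \<doteq> S b \<in> P \<Longrightarrow> follows_from P (G \<turnstile> a \<doteq> b)"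
| bot_E: "G \<turnstile> IsNat Bot \<in> P \<Longrightarrow> wf_trm p \<Longrightarrow> follows_from P (G \<turnstile> p)"
  \<comment> \<open>induction\<close>
| ind: "G \<turnstile> subst i Zero c \<in> P \<Longrightarrow>
    finsert (IsNat (Var i)) (finsert c G) \<turnstile> subst i (S (Var i)) c \<in> P \<Longrightarrow>
    G \<turnstile> IsNat a \<in> P \<Longrightarrow> wf_trm c \<Longrightarrow> \<forall>b. b |\<in>| G \<longrightarrow> i \<notin> fv b \<Longrightarrow>
    follows_from P (G \<turnstile> subst i a c)"
  \<comment> \<open>conversion\<close>
| conv_I: "c \<triangleright> c' \<Longrightarrow> G \<turnstile> c' \<in> P \<Longrightarrow> follows_from P (G \<turnstile> c)"
| conv_E: "c \<triangleright> c' \<Longrightarrow> G \<turnstile> c \<in> P \<Longrightarrow> follows_from P (G \<turnstile> c')"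
| conv_eq: "c \<triangleright> c' \<Longrightarrow> G \<turnstile> IsNat c' \<in> P \<Longrightarrow> follows_from P (G \<turnstile> c \<doteq> c')"
  \<comment> \<open>recursor\<close>
| rec_eq: "G \<turnstile> IsNat m \<in> P \<Longrightarrow> G \<turnstile> IsNat (h \<cdot> m \<cdot> (Rec \<cdot> g \<cdot> h \<cdot> m)) \<in> P \<Longrightarrow> wf_trm g \<Longrightarrow>
    follows_from P (G \<turnstile> Rec \<cdot> g \<cdot> h \<cdot> S m \<doteq> h \<cdot> m \<cdot> (Rec \<cdot> g \<cdot> h \<cdot> m))"
  \<comment> \<open>quantifier\<close>
| all_I: "finsert (IsNat (Var 0)) (up |`| G) \<turnstile> up f \<cdot> Var 0 \<in> P \<Longrightarrow>
    follows_from P (G \<turnstile> AllC \<cdot> f)"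
| all_E: "G \<turnstile> AllC \<cdot> f \<in> P \<Longrightarrow> G \<turnstile> IsNat a \<in> P \<Longrightarrow> follows_from P (G \<turnstile> f \<cdot> a)"
| neg_all_I: "G \<turnstile> Neg (f \<cdot> a) \<in> P \<Longrightarrow> G \<turnstile> IsNat a \<in> P \<Longrightarrow>
    follows_from P (G \<turnstile> Neg (AllC \<cdot> f))"
| neg_all_E: "G \<turnstile> Neg (AllC \<cdot> f) \<in> P \<Longrightarrow>
    finsert (IsNat (Var 0)) (finsert (Neg (up f \<cdot> Var 0)) (up |`| G)) \<turnstile> up c \<in> P \<Longrightarrow>
    follows_from P (G \<turnstile> c)"

definition is_proof :: "sequent list \<Rightarrow> bool" where
  "is_proof js \<longleftrightarrow> (\<forall>i<length js. follows_from (set (take i js)) (js ! i))"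

definition derivable :: "sequent \<Rightarrow> bool" where
  "derivable j \<longleftrightarrow> (\<exists>js. is_proof js \<and> j \<in> set js)"

end

theory Submission imports Defs
begin

text \<open>
The theorem is an existence property, and the proof is in the style of the Kleene slash: terms get
a semantics in which a negated universal can only be true because of a numeral counterexample, every
derivable sequent is valid in this semantics, and every true term is derivable without hypotheses.

The semantics is a big-step evaluation \<open>eval\<close> of a term, applied to a list of arguments, to a
natural number. A term is true when its value is 1, and its negation is true when its value is 0,
as in the rules for truth values. The value of \<open>AllC \<cdot> f\<close> is 0 when some \<open>f \<cdot> num n\<close> has value 0. It
is 1 when all \<open>f \<cdot> num n\<close> have value 1 (an omega rule) and in addition \<open>AllC \<cdot> f\<close> itself is derivable:
infinitely many derivable instances would not give a derivation of the universal, so derivability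
has to be part of the truth condition. With it, \<open>eval_provable\<close> shows that a term with value
\<open>n\<close> is provably equal to \<open>num n\<close>.

Terms are evaluated as they stand, whether closed or not: a free variable has no value. This matters
because \<open>u\<close> may have free variables. A sequent is sound if it preserves truth under every
well-formed parallel substitution; open terms are allowed as values of the substitution, and the
identity substitution gives back \<open>u\<close>.

Two rules carry the difficulty of soundness. The rule replacing equals by equals needs
\<open>eval_cong_args\<close>: terms with the same value are interchangeable in every context, also as the number
argument of a recursor. For this reason recursion evaluates its number argument and continues with
the numeral of the result, and it is essential that a term with a value has none when it is applied
to further arguments (\<open>eval_unique_args\<close>). The introduction rule for universals has to establish the
derivability demanded by the truth condition; this is where derivability must be closed under
parallel substitution (\<open>derivable_psubst\<close>) and under cutting the true, hence provable, hypotheses.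
\<close>

\<comment> \<open>Truth values and the binder count of \<open>Lam\<close> are written 1 in the rules; unfolding them to
  \<open>Suc 0\<close> would keep those rules from matching.\<close>
declare One_nat_def [simp del]

section \<open>Parallel substitution\<close>

definition lift :: "nat \<Rightarrow> (nat \<Rightarrow> trm) \<Rightarrow> nat \<Rightarrow> trm" where
  "lift k \<sigma> i = (if i < k then Var i else shift k 0 (\<sigma> (i - k)))"

fun psubst :: "(nat \<Rightarrow> trm) \<Rightarrow> trm \<Rightarrow> trm" where
  "psubst \<sigma> (Var i) = \<sigma> i"
| "psubst \<sigma> (Node f k ts) = Node f k (map (psubst (lift k \<sigma>)) ts)"

lemma shift_0 [simp]: "shift 0 c t = t"
  by (induction t arbitrary: c) (auto simp: map_idI)

lemma lift_0 [simp]: "lift 0 \<sigma> = \<sigma>"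
  by (auto simp: lift_def)

lemma psubst_cong: "(\<And>i. i \<in> fv t \<Longrightarrow> \<sigma> i = \<tau> i) \<Longrightarrow> psubst \<sigma> t = psubst \<tau> t"
proof (induction t arbitrary: \<sigma> \<tau>)
  case (Node f k ts)
  have "psubst (lift k \<sigma>) t = psubst (lift k \<tau>) t" if t: "t \<in> set ts" for t
  proof (rule Node.IH[OF t])
    fix i assume i: "i \<in> fv t"
    have "\<sigma> (i - k) = \<tau> (i - k)" if "\<not> i < k"
      by (rule Node.prems) (use t i that in auto)
    then show "lift k \<sigma> i = lift k \<tau> i" by (simp add: lift_def)
  qed
  then show ?case by simp
qed simp

lemma psubst_Var [simp]: "psubst Var t = t"
proof (induction t)
  case (Node f k ts)
  have "lift k Var = Var" by (auto simp: lift_def)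
  with Node show ?case by (simp add: map_idI)
qed simp

lemma shift_psubst: "shift d c t = psubst (\<lambda>i. Var (if i < c then i else i + d)) t"
proof (induction t arbitrary: c)
  case (Node f k ts)
  have "lift k (\<lambda>i. Var (if i < c then i else i + d)) = (\<lambda>i. Var (if i < c + k then i else i + d))"
    by (auto simp: lift_def fun_eq_iff)
  with Node show ?case by simp
qed simp

lemma subst_psubst: "subst v s t = psubst (Var(v := s)) t"
proof (induction t arbitrary: v s)
  case (Node f k ts)
  have "lift k (Var(v := s)) = Var(v + k := shift k 0 s)"
    by (auto simp: lift_def fun_eq_iff)
  with Node show ?case by (simp del: fun_upd_apply)
qed simp

lemma inst_psubst:
  "inst d s t = psubst (\<lambda>j. if j < d then Var j else if j = d then s else Var (j - 1)) t"
proof (induction t arbitrary: d s)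
  case (Node f k ts)
  have "lift k (\<lambda>j. if j < d then Var j else if j = d then s else Var (j - 1))
      = (\<lambda>j. if j < d + k then Var j else if j = d + k then shift k 0 s else Var (j - 1))"
    by (auto simp: lift_def fun_eq_iff)
  with Node show ?case by simp
qed simp

lemma beta_psubst: "beta t s = psubst (case_nat s Var) t"
  unfolding inst_psubst by (rule psubst_cong) (auto split: nat.split)

text \<open>That parallel substitutions compose has to be proved first for renamings on either side, since
lifting a substitution under a binder itself applies a renaming.\<close>

lemma psubst_rename: "psubst \<sigma> (psubst (\<lambda>i. Var (\<rho> i)) t) = psubst (\<lambda>i. \<sigma> (\<rho> i)) t"
proof (induction t arbitrary: \<sigma> \<rho>)
  case (Node f k ts)
  let ?\<rho> = "\<lambda>i. if i < k then i else \<rho> (i - k) + k"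
  have 1: "lift k (\<lambda>i. Var (\<rho> i)) = (\<lambda>i. Var (?\<rho> i))"
    by (auto simp: lift_def fun_eq_iff)
  have 2: "lift k (\<lambda>i. \<sigma> (\<rho> i)) = (\<lambda>i. lift k \<sigma> (?\<rho> i))"
    by (auto simp: lift_def fun_eq_iff)
  from Node show ?case by (simp add: 1 2)
qed simp

lemma shift_psubst_lift: "psubst (lift k \<sigma>) (shift k 0 t) = psubst (\<lambda>i. shift k 0 (\<sigma> i)) t"
  by (simp add: shift_psubst[of k 0 t] psubst_rename lift_def)

lemma rename_psubst:
  "psubst (\<lambda>i. Var (\<rho> i)) (psubst \<sigma> t) = psubst (\<lambda>i. psubst (\<lambda>i. Var (\<rho> i)) (\<sigma> i)) t"
proof (induction t arbitrary: \<sigma> \<rho>)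
  case (Node f k ts)
  let ?\<rho> = "\<lambda>i. if i < k then i else \<rho> (i - k) + k"
  have 1: "lift k (\<lambda>i. Var (\<rho> i)) = (\<lambda>i. Var (?\<rho> i))"
    by (auto simp: lift_def fun_eq_iff)
  have 2: "lift k (\<lambda>i. psubst (\<lambda>i. Var (\<rho> i)) (\<sigma> i)) = (\<lambda>i. psubst (\<lambda>i. Var (?\<rho> i)) (lift k \<sigma> i))"
    by (auto simp: lift_def fun_eq_iff shift_psubst psubst_rename)
  from Node show ?case by (simp add: 1 2)
qed simp

lemma psubst_psubst: "psubst \<sigma> (psubst \<tau> t) = psubst (\<lambda>i. psubst \<sigma> (\<tau> i)) t"
proof (induction t arbitrary: \<sigma> \<tau>)
  case (Node f k ts)
  have "shift k 0 (psubst \<sigma> t) = psubst (lift k \<sigma>) (shift k 0 t)" for t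
    unfolding shift_psubst_lift by (simp add: shift_psubst rename_psubst)
  then have "lift k (\<lambda>i. psubst \<sigma> (\<tau> i)) = (\<lambda>i. psubst (lift k \<sigma>) (lift k \<tau> i))"
    by (auto simp: lift_def fun_eq_iff)
  with Node show ?case by simp
qed simp

lemma psubst_case_nat_up: "psubst (case_nat s \<sigma>) (up t) = psubst \<sigma> t"
  by (simp add: shift_psubst psubst_psubst flip: Suc_eq_plus1)

lemma beta_up [simp]: "beta (up t) s = t"
  by (simp add: beta_psubst psubst_case_nat_up)

lemma psubst_beta: "psubst \<sigma> (beta b t) = beta (psubst (lift 1 \<sigma>) b) (psubst \<sigma> t)"
  unfolding beta_psubst psubst_psubst
  by (rule psubst_cong)
    (auto simp: lift_def psubst_case_nat_up split: nat.split)

text \<open>The substitution lemma for two beta-instances: contracting a redex commutes with replacing the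
outer index 0, which is what keeps \<open>eval_cong_args\<close> going through \<open>Lam\<close>.\<close>

lemma beta_beta: "beta (beta b t) s = beta (inst 1 (up s) b) (beta t s)"
proof -
  have "inst 1 (up s) b = psubst (lift 1 (case_nat s Var)) b"
    unfolding inst_psubst
    by (rule psubst_cong) (auto simp: lift_def split: nat.split)
  then show ?thesis
    using psubst_beta[of "case_nat s Var" t b] by (simp add: beta_psubst)
qed

lemma wf_psubst: "(\<And>i. wf_trm (\<sigma> i)) \<Longrightarrow> wf_trm (psubst \<sigma> t) \<longleftrightarrow> wf_trm t"
proof (induction t arbitrary: \<sigma>)
  case (Node f k ts)
  have shift: "wf_trm (shift d c t) \<longleftrightarrow> wf_trm t" for d c t
    by (induction t arbitrary: c) auto
  have "wf_trm (lift k \<sigma> i)" for i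
    using Node.prems by (auto simp: lift_def shift)
  then have "wf_trm (psubst (lift k \<sigma>) t) \<longleftrightarrow> wf_trm t" if "t \<in> set ts" for t
    using Node.IH[OF that] by blast
  then show ?case by auto
qed simp

lemma wf_shift [simp]: "wf_trm (shift d c t) \<longleftrightarrow> wf_trm t"
  by (simp add: shift_psubst wf_psubst)

lemma wf_inst: "wf_trm s \<Longrightarrow> wf_trm (inst d s t) \<longleftrightarrow> wf_trm t"
  by (simp add: inst_psubst wf_psubst)

lemma finite_fv: "finite (fv t)"
proof (induction t)
  case (Node f k ts)
  have "finite {i. i + k \<in> fv t}" if "t \<in> set ts" for t
    using finite_vimageI[OF Node.IH[OF that], of "\<lambda>i. i + k"] by (simp add: vimage_def)
  then show ?case by simp
qed simp

lemma wf_num [simp]: "wf_trm (num n)"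
  by (induction n) auto

lemma psubst_num [simp]: "psubst \<sigma> (num n) = num n"
  by (induction n arbitrary: \<sigma>) auto

lemma inst_num [simp]: "inst d s (num n) = num n"
  by (simp add: inst_psubst)

lemma head_step_psubst:
  assumes "c \<triangleright> c'" and wf: "\<And>i. wf_trm (\<sigma> i)"
  shows "psubst \<sigma> c \<triangleright> psubst \<sigma> c'"
  using assms(1)
proof induction
  case (hs_beta t b)
  then show ?case
    by (simp add: psubst_beta) (rule head_step.hs_beta, simp add: wf_psubst wf)
qed (auto intro!: head_step.intros simp: wf_psubst wf)

section \<open>Derivability\<close>

lemma follows_from_mono:
  assumes "follows_from P j" "P \<subseteq> Q"
  shows "follows_from Q j"
  using assms(1)
  by (induction rule: follows_from.induct)
    (use assms(2) in \<open>blast intro: follows_from.intros\<close>)+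

lemma is_proof_append:
  assumes "is_proof js" "is_proof ks"
  shows "is_proof (js @ ks)"
  unfolding is_proof_def
proof (intro allI impI)
  fix i assume i: "i < length (js @ ks)"
  show "follows_from (set (take i (js @ ks))) ((js @ ks) ! i)"
  proof (cases "i < length js")
    case True
    then show ?thesis using assms(1) by (simp add: is_proof_def nth_append)
  next
    case False
    then have "follows_from (set (take (i - length js) ks)) (ks ! (i - length js))"
      using assms(2) i by (simp add: is_proof_def)
    then show ?thesis
      using False by (auto simp: nth_append intro: follows_from_mono)
  qed
qed

lemma derivable_step:
  assumes "follows_from P j" "finite P" "\<And>p. p \<in> P \<Longrightarrow> derivable p"
  shows "derivable j"
proof -
  have "\<exists>js. is_proof js \<and> P \<subseteq> set js"
    using assms(2,3)
  proof (induction P)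
    case empty
    show ?case by (intro exI[of _ "[]"]) (simp add: is_proof_def)
  next
    case (insert p P)
    obtain js where js: "is_proof js" "P \<subseteq> set js" using insert by auto
    obtain ks where ks: "is_proof ks" "p \<in> set ks"
      using insert.prems by (auto simp: derivable_def)
    show ?case
      by (intro exI[of _ "js @ ks"]) (use js ks in \<open>auto intro: is_proof_append\<close>)
  qed
  then obtain js where js: "is_proof js" "P \<subseteq> set js" by blast
  have "is_proof (js @ [j])"
    unfolding is_proof_def
  proof (intro allI impI)
    fix i assume "i < length (js @ [j])"
    then show "follows_from (set (take i (js @ [j]))) ((js @ [j]) ! i)"
      using js follows_from_mono[OF assms(1)]
      by (cases "i = length js") (auto simp: is_proof_def nth_append)
  qed
  then show ?thesis by (auto simp: derivable_def)
qed

text \<open>In a proof, only earlier entries serve as premises, so strong induction on the position in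
the list gives rule induction for derivability.\<close>

lemma derivable_induct [consumes 1, case_names step]:
  assumes "derivable j"
    and step: "\<And>P j. follows_from P j \<Longrightarrow> (\<And>p. p \<in> P \<Longrightarrow> derivable p \<and> Q p) \<Longrightarrow> Q j"
  shows "Q j"
proof -
  obtain js where js: "is_proof js" "j \<in> set js" using assms(1) by (auto simp: derivable_def)
  have "Q (js ! i)" if "i < length js" for i
    using that
  proof (induction i rule: less_induct)
    case (less i)
    show ?case
    proof (rule step)
      show "follows_from (set (take i js)) (js ! i)" using js(1) less.prems by (simp add: is_proof_def)
    next
      fix p assume "p \<in> set (take i js)"
      then obtain m where "m < i" "p = js ! m" using less.prems by (auto simp: in_set_conv_nth)
      with less js(1) show "derivable p \<and> Q p" by (auto simp: derivable_def)
    qed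
  qed
  with js(2) show ?thesis by (metis in_set_conv_nth)
qed

lemma derivable_subst:
  assumes "derivable (G \<turnstile> c)" "\<forall>g. g |\<in>| G \<longrightarrow> wf_trm g" "wf_trm c" "wf_trm s"
  shows "derivable (subst v s |`| G \<turnstile> subst v s c)"
  by (rule derivable_step[of "{G \<turnstile> c}"]) (use assms in \<open>auto intro!: substitution\<close>)

text \<open>The rules offer only the replacement of one variable at a time, and performing these in sequence
would substitute into terms inserted before. So all relevant variables are first renamed, one by one,
to variables beyond any index that occurs, and then these are replaced one by one.\<close>

lemma derivable_psubst:
  assumes der: "derivable (G \<turnstile> c)" and G: "\<forall>g. g |\<in>| G \<longrightarrow> wf_trm g" and c: "wf_trm c"
    and wf: "\<And>i. wf_trm (\<sigma> i)"
  shows "derivable (psubst \<sigma> |`| G \<turnstile> psubst \<sigma> c)"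
proof -
  have "finite (fv c \<union> (\<Union>g\<in>fset G. fv g))" by (simp add: finite_fv)
  then obtain N where N: "\<And>i. i \<in> fv c \<union> (\<Union>g\<in>fset G. fv g) \<Longrightarrow> i < N"
    by (meson finite_nat_set_iff_bounded)
  have "finite (\<Union>i<N. fv (\<sigma> i))" by (simp add: finite_fv)
  then obtain M0 where M0: "\<And>i j. i < N \<Longrightarrow> j \<in> fv (\<sigma> i) \<Longrightarrow> j < M0"
    by (metis (no_types, lifting) UN_I finite_nat_set_iff_bounded lessThan_iff)
  \<comment> \<open>Above \<open>N\<close>, so that renaming by \<open>M\<close> does not hit variables still to be renamed; above the
    free indices of all \<open>\<sigma> i\<close>, so that later replacements leave the inserted terms alone.\<close>
  define M where "M = max M0 N"
  have M: "j < M" if "i < N" "j \<in> fv (\<sigma> i)" for i j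
    using M0[OF that] by (simp add: M_def)
  have NM: "N \<le> M" by (simp add: M_def)
  have step: "derivable (psubst \<tau>' |`| G \<turnstile> psubst \<tau>' c)"
    if d: "derivable (psubst \<tau> |`| G \<turnstile> psubst \<tau> c)" and \<tau>: "\<And>i. wf_trm (\<tau> i)" and s: "wf_trm s"
      and eq: "\<And>i. i < N \<Longrightarrow> psubst (Var(v := s)) (\<tau> i) = \<tau>' i" for \<tau> \<tau>' v s
  proof -
    have *: "subst v s (psubst \<tau> t) = psubst \<tau>' t" if "\<And>i. i \<in> fv t \<Longrightarrow> i < N" for t
      unfolding subst_psubst psubst_psubst by (rule psubst_cong) (simp add: eq that)
    have "derivable (subst v s |`| psubst \<tau> |`| G \<turnstile> subst v s (psubst \<tau> c))"
      by (rule derivable_subst[OF d]) (use G c s in \<open>auto simp: wf_psubst \<tau>\<close>)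
    moreover have "subst v s |`| psubst \<tau> |`| G = psubst \<tau>' |`| G"
      unfolding fset.map_comp by (rule fset.map_cong0) (use N in \<open>auto intro!: *\<close>)
    moreover have "subst v s (psubst \<tau> c) = psubst \<tau>' c"
      by (rule *) (use N in auto)
    ultimately show ?thesis by simp
  qed
  let ?r = "\<lambda>m i. if i < m then Var (i + M) else Var i"
  have r: "derivable (psubst (?r m) |`| G \<turnstile> psubst (?r m) c)" if "m \<le> N" for m
    using that
  proof (induction m)
    case 0
    have "psubst (\<lambda>i. Var i) |`| G = G" by (simp add: fset.map_ident_strong)
    then show ?case using der by simp
  next
    case (Suc m)
    show ?case
      by (rule step[of "?r m" "Var (m + M)" m]) (use Suc NM in auto)
  qed
  let ?s = "\<lambda>m i. if i < m then \<sigma> i else Var (i + M)"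
  have s: "derivable (psubst (?s m) |`| G \<turnstile> psubst (?s m) c)" if "m \<le> N" for m
    using that
  proof (induction m)
    case 0
    have *: "psubst (?r N) t = psubst (?s 0) t" if "\<And>i. i \<in> fv t \<Longrightarrow> i < N" for t
      by (rule psubst_cong) (auto dest: that)
    have G_eq: "psubst (?r N) |`| G = psubst (?s 0) |`| G"
      by (rule fset.map_cong0, rule *) (use N in auto)
    have c_eq: "psubst (?r N) c = psubst (?s 0) c" by (rule *) (use N in auto)
    show ?case using r[OF order_refl] unfolding G_eq c_eq .
  next
    case (Suc m)
    have *: "psubst (Var(m + M := \<sigma> m)) (\<sigma> i) = \<sigma> i" if "i < N" for i
    proof -
      have "psubst (Var(m + M := \<sigma> m)) (\<sigma> i) = psubst Var (\<sigma> i)"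
        by (rule psubst_cong) (use M[OF that] in force)
      then show ?thesis by simp
    qed
    show ?case
      by (rule step[of "?s m" "\<sigma> m" "m + M"]) (use Suc wf * in \<open>auto simp: less_Suc_eq\<close>)
  qed
  have *: "psubst (?s N) t = psubst \<sigma> t" if "\<And>i. i \<in> fv t \<Longrightarrow> i < N" for t
    by (rule psubst_cong) (auto dest: that)
  have G_eq: "psubst (?s N) |`| G = psubst \<sigma> |`| G"
    by (rule fset.map_cong0, rule *) (use N in auto)
  have c_eq: "psubst (?s N) c = psubst \<sigma> c" by (rule *) (use N in auto)
  show ?thesis using s[OF order_refl] unfolding G_eq c_eq .
qed

lemma derivable_cut_all:
  assumes "derivable (G \<turnstile> c)" "\<And>g. g |\<in>| G \<Longrightarrow> derivable ({||} \<turnstile> g)"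
  shows "derivable ({||} \<turnstile> c)"
  using assms
proof (induction G)
  case (insert g G)
  have weak: "derivable (H \<turnstile> g)" for H
  proof (induction H)
    case empty
    show ?case using insert.prems by simp
  next
    case (insert a H)
    show ?case by (rule derivable_step[of "{H \<turnstile> g}"]) (use insert in \<open>auto intro: weaken\<close>)
  qed
  have "derivable (G \<turnstile> c)"
    by (rule derivable_step[of "{G \<turnstile> g, finsert g G \<turnstile> c}"])
      (use insert.prems weak in \<open>auto intro: cut\<close>)
  then show ?case using insert by simp
qed simp

abbreviation provable :: "trm \<Rightarrow> bool" where "provable t \<equiv> derivable ({||} \<turnstile> t)"


lemma provable_from:
  assumes "follows_from {{||} \<turnstile> a, {||} \<turnstile> b} ({||} \<turnstile> c)" "provable a" "provable b"
  shows "provable c"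
  by (rule derivable_step[OF assms(1)]) (use assms in auto)

lemma provable_from1:
  assumes "follows_from {{||} \<turnstile> a} ({||} \<turnstile> c)" "provable a"
  shows "provable c"
  by (rule derivable_step[OF assms(1)]) (use assms in auto)

lemma provable_Zero: "provable (IsNat Zero)"
  by (rule derivable_step[of "{}"]) (auto intro: zero_nat)

lemmas provable_true_I = provable_from1[OF true_I[OF singletonI]]
lemmas provable_true_E = provable_from1[OF true_E[OF singletonI]]
lemmas provable_false_I = provable_from1[OF false_I[OF singletonI]]
lemmas provable_false_E = provable_from1[OF false_E[OF singletonI]]
lemmas provable_neg_neg_I = provable_from1[OF neg_neg_I[OF singletonI]]
lemmas provable_or_I1 = provable_from1[OF or_I1[OF singletonI]]
lemmas provable_or_I2 = provable_from1[OF or_I2[OF singletonI]]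
lemmas provable_eq_sym = provable_from1[OF eq_sym[OF singletonI]]
lemmas provable_suc_nat_I = provable_from1[OF suc_nat_I[OF singletonI]]
lemmas provable_suc_neq_zero = provable_from1[OF suc_neq_zero[OF singletonI]]
lemmas provable_neq_sym = provable_from1[OF neq_sym[OF singletonI]]
lemmas provable_suc_neq_I = provable_from1[OF suc_neq_I[OF singletonI]]
lemmas provable_conv_eq = provable_from1[OF conv_eq[OF _ singletonI]]
lemmas provable_neg_or_I = provable_from[OF neg_or_I[OF insertI1 insertI2[OF singletonI]]]
lemmas provable_neg_all_I = provable_from[OF neg_all_I[OF insertI1 insertI2[OF singletonI]]]
lemmas provable_eq_subst = provable_from[OF eq_subst[OF insertI1 insertI2[OF singletonI]]]

text \<open>Leibniz's law with the context given as a body with hole at index 0, the form that fits beta and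
spares choosing a fresh variable later.\<close>

lemma provable_replace:
  assumes ab: "provable (a \<doteq> b)" and p: "provable (beta p a)" and wf: "wf_trm p"
  shows "provable (beta p b)"
proof -
  have "finite {i. Suc i \<in> fv p}"
    using finite_vimageI[OF finite_fv, of Suc p] by (simp add: vimage_def)
  then obtain v where v: "Suc v \<notin> fv p" using ex_new_if_finite by auto
  let ?p = "psubst (case_nat (Var v) Var) p"
  have *: "subst v s ?p = beta p s" for s
    unfolding subst_psubst psubst_psubst beta_psubst
    by (rule psubst_cong) (use v in \<open>auto split: nat.split\<close>)
  have "wf_trm ?p" by (subst wf_psubst) (auto simp: wf split: nat.split)
  then have "provable (subst v b ?p)"
    by (rule provable_eq_subst[OF _ ab]) (simp add: * p)
  then show ?thesis by (simp add: *)
qed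

lemma provable_num: "provable (IsNat (num n))"
  by (induction n) (auto intro: provable_Zero provable_suc_nat_I)

lemma provable_num_neq: "n \<noteq> m \<Longrightarrow> provable (Neq (num n) (num m))"
proof (induction n arbitrary: m)
  case 0
  then obtain k where "m = Suc k" by (cases m) auto
  then show ?case
    using provable_neq_sym[OF provable_suc_neq_zero[OF provable_num[of k]]] by simp
next
  case (Suc n)
  show ?case
  proof (cases m)
    case 0
    then show ?thesis using provable_suc_neq_zero[OF provable_num[of n]] by simp
  next
    case (Suc k)
    then show ?thesis using Suc.IH[of k] Suc.prems by (auto intro: provable_suc_neq_I)
  qed
qed

lemma provable_trans:
  assumes "provable (a \<doteq> b)" "provable (b \<doteq> c)" "wf_trm c"
  shows "provable (a \<doteq> c)"
  using provable_replace[of b a "Var 0 \<doteq> up c"] assms provable_eq_sym[OF assms(1)] by simp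

section \<open>Evaluation\<close>

text \<open>The list holds the arguments that the term is applied to, so a head redex deep in an
application spine is found by structural steps only. The well-formedness premises mirror the side
conditions of the head steps and of the disjunction rules; with them, only well-formed terms have
values.\<close>

inductive eval :: "trm \<Rightarrow> trm list \<Rightarrow> nat \<Rightarrow> bool" where
  Zero: "eval Zero [] 0"
| Suc: "eval a [] n \<Longrightarrow> eval (S a) [] (Suc n)"
| Neg_true: "eval a [] 1 \<Longrightarrow> eval (Neg a) [] 0"
| Neg_false: "eval a [] 0 \<Longrightarrow> eval (Neg a) [] 1"
| Or1: "eval a [] 1 \<Longrightarrow> wf_trm b \<Longrightarrow> eval (Or a b) [] 1"
| Or2: "eval b [] 1 \<Longrightarrow> wf_trm a \<Longrightarrow> eval (Or a b) [] 1"
| Or_false: "eval a [] 0 \<Longrightarrow> eval b [] 0 \<Longrightarrow> eval (Or a b) [] 0"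
| Eq_true: "eval a [] n \<Longrightarrow> eval b [] n \<Longrightarrow> eval (a \<doteq> b) [] 1"
| Eq_false: "eval a [] n \<Longrightarrow> eval b [] m \<Longrightarrow> n \<noteq> m \<Longrightarrow> eval (a \<doteq> b) [] 0"
| All_true: "(\<And>n. eval f [num n] 1) \<Longrightarrow> provable (AllC \<cdot> f) \<Longrightarrow> eval AllC [f] 1"
| All_false: "eval f [num n] 0 \<Longrightarrow> eval AllC [f] 0"
| App: "eval t (u # us) n \<Longrightarrow> eval (t \<cdot> u) us n"
| Lam: "eval (beta b t) us n \<Longrightarrow> wf_trm t \<Longrightarrow> eval (Lam b) (t # us) n"
| Rec_Zero: "eval a [] 0 \<Longrightarrow> eval g us n \<Longrightarrow> wf_trm h \<Longrightarrow> eval Rec (g # h # a # us) n"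
| Rec_Suc: "eval a [] (Suc k) \<Longrightarrow> eval h (num k # Rec \<cdot> g \<cdot> h \<cdot> num k # us) n \<Longrightarrow> wf_trm g \<Longrightarrow>
    eval Rec (g # h # a # us) n"

inductive_cases eval_ZeroE: "eval Zero us n"
inductive_cases eval_SucE: "eval (S a) us n"
inductive_cases eval_NegE: "eval (Neg a) us n"
inductive_cases eval_OrE: "eval (Or a b) us n"
inductive_cases eval_EqE: "eval (a \<doteq> b) us n"
inductive_cases eval_AllE: "eval AllC us n"
inductive_cases eval_AppE: "eval (t \<cdot> u) us n"
inductive_cases eval_LamE: "eval (Lam b) us n"
inductive_cases eval_RecE: "eval Rec us n"
inductive_cases eval_BotE: "eval Bot us n"

lemma eval_wf: "eval t us n \<Longrightarrow> wf_trm t \<and> (\<forall>u\<in>set us. wf_trm u)"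
  by (induction rule: eval.induct) (auto simp: wf_inst)

lemma eval_num: "eval (num n) [] n"
  by (induction n) (auto intro: eval.intros)

text \<open>Besides being functional, evaluation never lets a number act as a function. Both parts are needed
together because the induction passes through applications. The second is what excludes that, in
\<open>eval_cong_args\<close>, a term replaced for its value occurs in head position with arguments.\<close>

lemma eval_unique_args: "eval t us n \<Longrightarrow> eval t (us @ vs) m \<Longrightarrow> vs = [] \<and> m = n"
proof (induction arbitrary: vs m rule: eval.induct)
  case (Suc a n)
  from Suc.prems show ?case by (rule eval_SucE) (auto dest!: Suc.IH[of "[]", simplified])
next
  case (Neg_true a)
  from Neg_true.prems show ?case by (rule eval_NegE) (auto dest!: Neg_true.IH[of "[]", simplified])
next
  case (Neg_false a)
  from Neg_false.prems show ?case by (rule eval_NegE) (auto dest!: Neg_false.IH[of "[]", simplified])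
next
  case (Or1 a b)
  from Or1.prems show ?case by (rule eval_OrE) (auto dest!: Or1.IH[of "[]", simplified])
next
  case (Or2 a b)
  from Or2.prems show ?case by (rule eval_OrE) (auto dest!: Or2.IH[of "[]", simplified])
next
  case (Or_false a b)
  from Or_false.prems show ?case by (rule eval_OrE) (auto dest!: Or_false.IH[of "[]", simplified])
next
  case (Eq_true a n b)
  from Eq_true.prems show ?case by (rule eval_EqE) (auto dest!: Eq_true.IH[of "[]", simplified])
next
  case (Eq_false a n b l)
  from Eq_false.prems show ?case by (rule eval_EqE) 
    (use Eq_false.hyps in \<open>auto dest!: Eq_false.IH[of "[]", simplified]\<close>)
next
  case (All_true f)
  from All_true.prems show ?case by (rule eval_AllE) (auto dest!: All_true.IH[of _ "[]", simplified])
next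
  case (All_false f n)
  from All_false.prems show ?case
    by (rule eval_AllE) (use All_false.IH[of "[]" 1] All_false.IH[of "[]" 0] in auto)
next
  case (App t u us n)
  from App.prems show ?case by (rule eval_AppE) (auto dest!: App.IH[simplified])
next
  case (Lam b t us n)
  from Lam.prems show ?case by (rule eval_LamE) (auto dest!: Lam.IH[simplified])
next
  case (Rec_Zero a g us n h)
  from Rec_Zero.prems show ?case
    by (rule eval_RecE) (auto dest!: Rec_Zero.IH(1)[of "[]", simplified] Rec_Zero.IH(2)[simplified])
next
  case (Rec_Suc a k h g us n)
  from Rec_Suc.prems show ?case
    by (rule eval_RecE) (auto dest!: Rec_Suc.IH(1)[of "[]", simplified] Rec_Suc.IH(2)[simplified])
qed (auto elim: eval_ZeroE)

lemma eval_unique: "eval t [] n \<Longrightarrow> eval t us m \<Longrightarrow> us = [] \<and> m = n"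
  using eval_unique_args[of t "[]" n us m] by simp

section \<open>Provability of values\<close>

lemma beta_foldl_up [simp]:
  "beta (foldl (\<cdot>) t (map up us)) s = foldl (\<cdot>) (beta t s) us"
  by (induction us arbitrary: t rule: rev_induct) auto

lemma wf_foldl [simp]:
  "wf_trm (foldl (\<cdot>) t us) \<longleftrightarrow> wf_trm t \<and> (\<forall>u\<in>set us. wf_trm u)"
  by (induction us arbitrary: t rule: rev_induct) auto

lemma head_step_foldl: "t \<triangleright> t' \<Longrightarrow> foldl (\<cdot>) t us \<triangleright> foldl (\<cdot>) t' us"
  by (induction us rule: rev_induct) (auto intro: hs_app)

text \<open>The conversion rule for equations asks that the reduct is a natural number; being provably equal
to a numeral gives this.\<close>

lemma provable_head_step:
  assumes "t \<triangleright> t'" "provable (foldl (\<cdot>) t' us \<doteq> num n)" 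
  shows "provable (foldl (\<cdot>) t us \<doteq> num n)"
proof -
  let ?t = "foldl (\<cdot>) t us" and ?t' = "foldl (\<cdot>) t' us"
  have "provable (IsNat ?t')"
    using provable_replace[of "num n" ?t' "Var 0 \<doteq> Var 0"] provable_num
      provable_eq_sym[OF assms(2)] by simp
  then have "provable (?t \<doteq> ?t')"
    by (rule provable_conv_eq[OF head_step_foldl[OF assms(1)]])
  then show ?thesis by (rule provable_trans[OF _ assms(2)]) simp
qed

text \<open>Head steps of the recursor need a literal numeral, whereas evaluation admits any argument with a
value; Leibniz's law closes the gap.\<close>

lemma provable_rec_arg:
  assumes "provable (a \<doteq> num k)" "provable (foldl (\<cdot>) (Rec \<cdot> g \<cdot> h \<cdot> num k) us \<doteq> num n)"
    and "wf_trm g" "wf_trm h" "\<forall>u\<in>set us. wf_trm u"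
  shows "provable (foldl (\<cdot>) (Rec \<cdot> g \<cdot> h \<cdot> a) us \<doteq> num n)"
  using provable_replace[of "num k" a
      "foldl (\<cdot>) (Rec \<cdot> up g \<cdot> up h \<cdot> Var 0) (map up us) \<doteq> num n"]
    provable_eq_sym[OF assms(1)] assms(2-) by auto

lemma eval_provable: "eval t us n \<Longrightarrow> provable (foldl (\<cdot>) t us \<doteq> num n)"
proof (induction rule: eval.induct)
  case Zero
  show ?case by (simp add: provable_Zero)
next
  case (Suc a n)
  then show ?case
    using provable_replace[of "num n" a "S (Var 0) \<doteq> S (num n)"] provable_num[of "Suc n"]
      provable_eq_sym[of a] by simp
next
  case (Neg_true a)
  then have "provable (Neg (Neg a))" by (simp add: provable_true_E provable_neg_neg_I)
  from provable_false_I[OF this] show ?case by simp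
next
  case (Neg_false a)
  then have "provable (Neg a)" by (simp add: provable_false_E)
  from provable_true_I[OF this] show ?case by simp
next
  case (Or1 a b)
  then have "provable (Or a b)" by (simp add: provable_true_E provable_or_I1)
  from provable_true_I[OF this] show ?case by simp
next
  case (Or2 b a)
  then have "provable (Or a b)" by (simp add: provable_true_E provable_or_I2)
  from provable_true_I[OF this] show ?case by simp
next
  case (Or_false a b)
  then have "provable (Neg (Or a b))"
    using provable_false_E[of a] provable_false_E[of b] by (simp add: provable_neg_or_I)
  from provable_false_I[OF this] show ?case by simp
next
  case (Eq_true a n b)
  then have "provable (a \<doteq> b)"
    using provable_trans[of a "num n" b] provable_eq_sym[of b] eval_wf by simp
  from provable_true_I[OF this] show ?case by simp
next
  case (Eq_false a n b m)
  then have "provable (Neq (num n) b)"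
    using provable_replace[of "num m" b "Neq (num n) (Var 0)"] provable_num_neq[of n m]
      provable_eq_sym[of b] by simp
  then have "provable (Neq a b)"
    using provable_replace[of "num n" a "Neq (Var 0) (up b)"] Eq_false
      provable_eq_sym[of a] eval_wf by simp
  from provable_false_I[OF this] show ?case by simp
next
  case (All_true f)
  from provable_true_I[OF All_true.hyps(2)] show ?case by simp
next
  case (All_false f n)
  then have "provable (Neg (f \<cdot> num n))" by (simp add: provable_false_E)
  then have "provable (Neg (AllC \<cdot> f))" by (rule provable_neg_all_I) (rule provable_num)
  from provable_false_I[OF this] show ?case by simp
next
  case (App t u us n)
  then show ?case by simp
next
  case (Lam b t us n)
  then show ?case using provable_head_step[OF hs_beta] by simp
next
  case (Rec_Zero a g us n h)
  have "provable (foldl (\<cdot>) (Rec \<cdot> g \<cdot> h \<cdot> num 0) us \<doteq> num n)"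
    using provable_head_step[OF hs_rec0] Rec_Zero by simp
  then have "provable (foldl (\<cdot>) (Rec \<cdot> g \<cdot> h \<cdot> a) us \<doteq> num n)"
    by (rule provable_rec_arg[rotated]) (use Rec_Zero eval_wf in auto)
  then show ?case by simp
next
  case (Rec_Suc a k h g us n)
  have "provable (foldl (\<cdot>) (Rec \<cdot> g \<cdot> h \<cdot> num (Suc k)) us \<doteq> num n)"
    using provable_head_step[OF hs_recS] Rec_Suc by simp
  then have "provable (foldl (\<cdot>) (Rec \<cdot> g \<cdot> h \<cdot> a) us \<doteq> num n)"
    by (rule provable_rec_arg[rotated]) (use Rec_Suc eval_wf in auto)
  then show ?case by simp
qed

lemma eval_true_provable: "eval t [] 1 \<Longrightarrow> provable t"
  using eval_provable[of t "[]" 1] by (simp add: provable_true_E)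


section \<open>Interchangeability of terms with the same value\<close>

lemma inst_eq_Node:
  "beta p a = Node f k ts \<Longrightarrow> p \<noteq> Var 0 \<Longrightarrow>
    \<exists>ps. p = Node f k ps \<and> ts = map (inst k (shift k 0 a)) ps"
  by (cases p) (auto split: if_splits)

text \<open>Replacing \<open>a\<close> by \<open>b\<close> of the same value in term and arguments. By induction on the evaluation: a
step either works on structure shared by both sides, or it has reached an occurrence of \<open>a\<close>
itself. In the latter case there are no pending arguments, as \<open>a\<close> has a value, and \<open>b\<close> has the same
value by assumption. A universal also needs derivability for \<open>b\<close>, which follows since \<open>a\<close> and
\<open>b\<close> are provably equal.\<close>

lemma eval_cong_args:
  assumes a: "eval a [] k" and b: "eval b [] k"
  shows "eval t us n \<Longrightarrow> t = beta p a \<Longrightarrow> us = map (inst 0 a) qs \<Longrightarrow>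
    eval (beta p b) (map (inst 0 b) qs) n"
proof (induction arbitrary: p qs rule: eval.induct)
  note wfa = eval_wf[OF a] and wfb = eval_wf[OF b]
  \<comment> \<open>Index 0 is the hole, so \<open>p = Var 0\<close> is the case of an occurrence of \<open>a\<close> in head position.\<close>
  have hole: "eval (beta p b) (map (inst 0 b) qs) n"
    if "p = Var 0" "eval t us n" "t = beta p a" "us = map (inst 0 a) qs" for t us n p qs
    using that b eval_unique[OF a, of us n] by auto
  {
    case Zero
    show ?case
    proof (cases "p = Var 0")
      case True
      then show ?thesis using Zero by (intro hole[OF _ eval.Zero])
    next
      case False
      with Zero show ?thesis by (auto dest!: inst_eq_Node[OF sym] intro: eval.Zero)
    qed
  next
    case (Suc a' n)
    show ?case
    proof (cases "p = Var 0")
      case True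
      then show ?thesis using Suc.prems by (intro hole[OF _ eval.Suc[OF Suc.hyps]])
    next
      case False
      with Suc.prems obtain p1 where "p = S p1" "a' = beta p1 a" "qs = []"
        by (auto dest!: inst_eq_Node[OF sym])
      then show ?thesis using Suc.IH[of p1 "[]"] by (auto intro: eval.Suc)
    qed
  next
    case (Neg_true a')
    show ?case
    proof (cases "p = Var 0")
      case True
      then show ?thesis using Neg_true.prems by (intro hole[OF _ eval.Neg_true[OF Neg_true.hyps]])
    next
      case False
      with Neg_true.prems obtain p1 where "p = Neg p1" "a' = beta p1 a" "qs = []"
        by (auto dest!: inst_eq_Node[OF sym])
      then show ?thesis using Neg_true.IH[of p1 "[]"] by (auto intro: eval.Neg_true)
    qed
  next
    case (Neg_false a')
    show ?case
    proof (cases "p = Var 0")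
      case True
      then show ?thesis using Neg_false.prems by (intro hole[OF _ eval.Neg_false[OF Neg_false.hyps]])
    next
      case False
      with Neg_false.prems obtain p1 where "p = Neg p1" "a' = beta p1 a" "qs = []"
        by (auto dest!: inst_eq_Node[OF sym])
      then show ?thesis using Neg_false.IH[of p1 "[]"] by (auto intro: eval.Neg_false)
    qed
  next
    case (Or1 a' b')
    show ?case
    proof (cases "p = Var 0")
      case True
      then show ?thesis using Or1.prems by (intro hole[OF _ eval.Or1[OF Or1.hyps]])
    next
      case False
      with Or1.prems obtain p1 p2 where "p = Or p1 p2" "a' = beta p1 a" "b' = beta p2 a" "qs = []"
        by (auto dest!: inst_eq_Node[OF sym])
      then show ?thesis
        using Or1.IH[of p1 "[]"] Or1.hyps wfa wfb by (auto intro!: eval.Or1 simp: wf_inst)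
    qed
  next
    case (Or2 b' a')
    show ?case
    proof (cases "p = Var 0")
      case True
      then show ?thesis using Or2.prems by (intro hole[OF _ eval.Or2[OF Or2.hyps]])
    next
      case False
      with Or2.prems obtain p1 p2 where "p = Or p1 p2" "a' = beta p1 a" "b' = beta p2 a" "qs = []"
        by (auto dest!: inst_eq_Node[OF sym])
      then show ?thesis
        using Or2.IH[of p2 "[]"] Or2.hyps wfa wfb by (auto intro!: eval.Or2 simp: wf_inst)
    qed
  next
    case (Or_false a' b')
    show ?case
    proof (cases "p = Var 0")
      case True
      then show ?thesis using Or_false.prems by (intro hole[OF _ eval.Or_false[OF Or_false.hyps]])
    next
      case False
      with Or_false.prems obtain p1 p2
        where "p = Or p1 p2" "a' = beta p1 a" "b' = beta p2 a" "qs = []"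
        by (auto dest!: inst_eq_Node[OF sym])
      then show ?thesis
        using Or_false.IH(1)[of p1 "[]"] Or_false.IH(2)[of p2 "[]"] by (auto intro!: eval.Or_false)
    qed
  next
    case (Eq_true a' n b')
    show ?case
    proof (cases "p = Var 0")
      case True
      then show ?thesis using Eq_true.prems by (intro hole[OF _ eval.Eq_true[OF Eq_true.hyps]])
    next
      case False
      with Eq_true.prems obtain p1 p2
        where "p = p1 \<doteq> p2" "a' = beta p1 a" "b' = beta p2 a" "qs = []"
        by (auto dest!: inst_eq_Node[OF sym])
      then show ?thesis
        using Eq_true.IH(1)[of p1 "[]"] Eq_true.IH(2)[of p2 "[]"] by (auto intro!: eval.Eq_true)
    qed
  next
    case (Eq_false a' n b' m)
    show ?case
    proof (cases "p = Var 0")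
      case True
      then show ?thesis using Eq_false.prems by (intro hole[OF _ eval.Eq_false[OF Eq_false.hyps]])
    next
      case False
      with Eq_false.prems obtain p1 p2
        where "p = p1 \<doteq> p2" "a' = beta p1 a" "b' = beta p2 a" "qs = []"
        by (auto dest!: inst_eq_Node[OF sym])
      then show ?thesis
        using Eq_false.IH(1)[of p1 "[]"] Eq_false.IH(2)[of p2 "[]"] Eq_false.hyps
        by (auto intro!: eval.Eq_false)
    qed
  next
    case (All_true f)
    show ?case
    proof (cases "p = Var 0")
      case True
      then show ?thesis using All_true.prems by (intro hole[OF _ eval.All_true[OF All_true.hyps]])
    next
      case False
      with All_true.prems obtain q where q: "p = AllC" "f = beta q a" "qs = [q]"
        by (auto dest!: inst_eq_Node[OF sym])
      have ab: "provable (a \<doteq> b)"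
        using provable_trans[of a "num k" b] eval_provable[OF a] eval_provable[OF b]
          provable_eq_sym[of b] wfb by simp
      have "wf_trm q"
        using eval_wf[OF All_true.hyps(1)] wfa q by (simp add: wf_inst)
      then have "provable (AllC \<cdot> beta q b)"
        using provable_replace[OF ab, of "AllC \<cdot> q"] All_true.hyps(2) q by simp
      then show ?thesis
        using q All_true.IH[of q n "[num n]" for n] by (auto intro!: eval.All_true)
    qed
  next
    case (All_false f n)
    show ?case
    proof (cases "p = Var 0")
      case True
      then show ?thesis using All_false.prems by (intro hole[OF _ eval.All_false[OF All_false.hyps]])
    next
      case False
      with All_false.prems obtain q where "p = AllC" "f = beta q a" "qs = [q]"
        by (auto dest!: inst_eq_Node[OF sym])
      then show ?thesis using All_false.IH[of q "[num n]"] by (auto intro: eval.All_false)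
    qed
  next
    case (App t u us n)
    show ?case
    proof (cases "p = Var 0")
      case True
      then show ?thesis using App.prems by (intro hole[OF _ eval.App[OF App.hyps]])
    next
      case False
      with App.prems obtain p1 p2 where "p = p1 \<cdot> p2" "t = beta p1 a" "u = beta p2 a"
        by (auto dest!: inst_eq_Node[OF sym])
      then show ?thesis using App.IH[of p1 "p2 # qs"] App.prems by (auto intro: eval.App)
    qed
  next
    case (Lam c t us n)
    show ?case
    proof (cases "p = Var 0")
      case True
      then show ?thesis using Lam.prems by (intro hole[OF _ eval.Lam[OF Lam.hyps]])
    next
      case False
      with Lam.prems obtain p1 q qs' where p: "p = Lam p1" "c = inst 1 (up a) p1"
        "qs = q # qs'" "t = beta q a" "us = map (inst 0 a) qs'"
        by (auto dest!: inst_eq_Node[OF sym])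
      then have "eval (beta (beta p1 q) b) (map (inst 0 b) qs') n"
        by (intro Lam.IH) (simp_all add: beta_beta)
      then show ?thesis
        using p Lam.hyps wfa wfb by (auto simp: beta_beta wf_inst intro!: eval.Lam)
    qed
  next
    case (Rec_Zero a' g us n h)
    show ?case
    proof (cases "p = Var 0")
      case True
      then show ?thesis using Rec_Zero.prems by (intro hole[OF _ eval.Rec_Zero[OF Rec_Zero.hyps]])
    next
      case False
      with Rec_Zero.prems obtain q1 q2 q3 qs' where "p = Rec" "qs = q1 # q2 # q3 # qs'"
        "g = beta q1 a" "h = beta q2 a" "a' = beta q3 a" "us = map (inst 0 a) qs'"
        by (auto dest!: inst_eq_Node[OF sym])
      then show ?thesis
        using Rec_Zero.IH(1)[of q3 "[]"] Rec_Zero.IH(2)[of q1 qs'] Rec_Zero.hyps wfa wfb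
        by (auto simp: wf_inst intro!: eval.Rec_Zero)
    qed
  next
    case (Rec_Suc a' m h g us n)
    show ?case
    proof (cases "p = Var 0")
      case True
      then show ?thesis using Rec_Suc.prems by (intro hole[OF _ eval.Rec_Suc[OF Rec_Suc.hyps]])
    next
      case False
      with Rec_Suc.prems obtain q1 q2 q3 qs' where "p = Rec" "qs = q1 # q2 # q3 # qs'"
        "g = beta q1 a" "h = beta q2 a" "a' = beta q3 a" "us = map (inst 0 a) qs'"
        by (auto dest!: inst_eq_Node[OF sym])
      then show ?thesis
        using Rec_Suc.IH(1)[of q3 "[]"] Rec_Suc.hyps wfa wfb
          Rec_Suc.IH(2)[of q2 "num m # (Rec \<cdot> q1 \<cdot> q2 \<cdot> num m) # qs'"]
        by (auto simp: wf_inst intro!: eval.Rec_Suc)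
    qed
  }
qed

lemma eval_cong:
  assumes "eval a [] k" "eval b [] k"
  shows "eval (beta p a) [] n \<longleftrightarrow> eval (beta p b) [] n"
  using eval_cong_args[OF assms _ refl, of p "[]" n] eval_cong_args[OF assms(2,1) _ refl, of p "[]" n]
  by auto

lemma eval_App_iff: "eval (t \<cdot> u) us n \<longleftrightarrow> eval t (u # us) n"
  by (auto intro: eval.App elim: eval_AppE)

lemma eval_head_step: "c \<triangleright> c' \<Longrightarrow> eval c us n \<longleftrightarrow> eval c' us n"
proof (induction arbitrary: us rule: head_step.induct)
  case (hs_beta t b)
  then show ?case by (auto simp: eval_App_iff intro: eval.Lam elim: eval_LamE)
next
  case (hs_rec0 h g)
  then show ?case
    by (auto simp: eval_App_iff intro: eval.Rec_Zero eval.Zero elim!: eval_RecE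
        dest: eval_unique[OF eval.Zero])
next
  case (hs_recS g h m)
  have S: "eval (S (num m)) [] (Suc m)" by (intro eval.Suc eval_num)
  show ?case
    unfolding eval_App_iff
    by (auto intro: eval.Rec_Suc[OF S] hs_recS elim!: eval_RecE dest: eval_unique[OF S])
next
  case (hs_app t t' u)
  then show ?case by (simp add: eval_App_iff)
qed

section \<open>Soundness\<close>

text \<open>Quantifying over all substitutions is what makes the substitution rule and the rules with a fresh
variable sound; a hypothesis that is not well-formed has no true instance.\<close>

fun sound :: "sequent \<Rightarrow> bool" where
  "sound (G \<turnstile> c) \<longleftrightarrow> (\<forall>\<sigma>. (\<forall>i. wf_trm (\<sigma> i)) \<longrightarrow> (\<forall>g. g |\<in>| G \<longrightarrow> eval (psubst \<sigma> g) [] 1) \<longrightarrow>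
    eval (psubst \<sigma> c) [] 1)"

lemma eval_Neg_iff: "eval (Neg a) [] n \<longleftrightarrow> n = 0 \<and> eval a [] 1 \<or> n = 1 \<and> eval a [] 0"
  by (auto intro: eval.intros elim: eval_NegE)

lemma eval_Or_iff: "eval (Or a b) [] n \<longleftrightarrow>
    n = 1 \<and> (eval a [] 1 \<and> wf_trm b \<or> eval b [] 1 \<and> wf_trm a) \<or> n = 0 \<and> eval a [] 0 \<and> eval b [] 0"
  by (auto intro: eval.intros elim: eval_OrE)

lemma eval_Eq_iff: "eval (a \<doteq> b) [] n \<longleftrightarrow>
    (\<exists>k l. eval a [] k \<and> eval b [] l \<and> n = (if k = l then 1 else 0))"
  by (auto intro: eval.intros elim!: eval_EqE)

lemma eval_Eq_commute: "eval (a \<doteq> b) [] n \<longleftrightarrow> eval (b \<doteq> a) [] n"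
  unfolding eval_Eq_iff by metis

lemma eval_Suc_iff: "eval (S a) [] n \<longleftrightarrow> (\<exists>k. eval a [] k \<and> n = Suc k)"
  by (auto intro: eval.intros elim: eval_SucE)

lemma eval_Zero_iff: "eval Zero [] n \<longleftrightarrow> n = 0"
  by (auto intro: eval.intros elim: eval_ZeroE)

lemmas eval_iffs = eval_Neg_iff eval_Or_iff eval_Eq_iff eval_Suc_iff eval_Zero_iff eval_App_iff


lemma eval_not_both: "eval a [] 0 \<Longrightarrow> \<not> eval a [] 1"
  by (auto dest: eval_unique)

lemma eval_eq_bool:
  assumes "eval a [] k" "eval b [] l"
  shows "eval (IsBool (a \<doteq> b)) [] 1"
proof -
  have "eval (a \<doteq> b) [] (if k = l then 1 else 0)" using assms by (auto simp: eval_Eq_iff)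
  then show ?thesis using eval_wf[OF assms(1)] eval_wf[OF assms(2)]
    by (cases "k = l") (auto simp: eval_Or_iff eval_Neg_iff)
qed

lemma soundD:
  assumes "sound (G \<turnstile> c)" "\<And>i. wf_trm (\<sigma> i)" "\<And>g. g |\<in>| G \<Longrightarrow> eval (psubst \<sigma> g) [] 1"
  shows "eval (psubst \<sigma> c) [] 1"
  using assms by simp

lemma sound_mono:
  assumes "sound (G \<turnstile> a)"
    and "\<And>\<sigma>. (\<And>i. wf_trm (\<sigma> i)) \<Longrightarrow> eval (psubst \<sigma> a) [] 1 \<Longrightarrow> eval (psubst \<sigma> c) [] 1"
  shows "sound (G \<turnstile> c)"
  using assms unfolding sound.simps by blast

lemma sound_mono2:
  assumes "sound (G \<turnstile> a)" "sound (G \<turnstile> b)"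
    and "\<And>\<sigma>. (\<And>i. wf_trm (\<sigma> i)) \<Longrightarrow> eval (psubst \<sigma> a) [] 1 \<Longrightarrow> eval (psubst \<sigma> b) [] 1 \<Longrightarrow>
      eval (psubst \<sigma> c) [] 1"
  shows "sound (G \<turnstile> c)"
  using assms unfolding sound.simps by blast

text \<open>Puts an instance of a single replacement in the form of a beta-instance whose body does not depend
on the replaced term, so that \<open>eval_cong\<close> applies.\<close>

lemma psubst_subst:
  "psubst \<sigma> (subst v s p) =
    beta (psubst (\<lambda>i. if i = v then Var 0 else up (\<sigma> i)) p) (psubst \<sigma> s)"
  unfolding subst_psubst psubst_psubst beta_psubst
  by (rule psubst_cong) (auto simp: psubst_case_nat_up)

lemma eval_arg_num:
  assumes "eval a [] k"
  shows "eval (f \<cdot> a) [] n \<longleftrightarrow> eval f [num k] n"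
  using eval_cong[OF assms eval_num, of "up f \<cdot> Var 0" n] by (simp add: eval_App_iff)

lemma follows_from_sound:
  assumes "follows_from P j" and derivable_P: "\<And>p. p \<in> P \<Longrightarrow> derivable p"
    and sound_P: "\<And>p. p \<in> P \<Longrightarrow> sound p"
  shows "sound j"
  using assms(1)
proof cases
  case (hyp c G)
  then show ?thesis by auto
next
  case (weaken G c a)
  then show ?thesis using sound_P[OF weaken(2)] by auto
next
  case (cut G a c)
  then show ?thesis using sound_P[OF cut(2)] sound_P[OF cut(3)] by auto
next
  case (substitution G c s v)
  have *: "psubst \<sigma> (subst v s t) = psubst (\<sigma>(v := psubst \<sigma> s)) t" for \<sigma> t
    unfolding subst_psubst psubst_psubst by (rule psubst_cong) simp
  show ?thesis
    unfolding substitution(1) sound.simps *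
  proof (intro allI impI)
    fix \<sigma>
    assume \<sigma>: "\<forall>i. wf_trm (\<sigma> i)"
      and G: "\<forall>g. g |\<in>| subst v s |`| G \<longrightarrow> eval (psubst \<sigma> g) [] 1"
    have "eval (psubst (\<sigma>(v := psubst \<sigma> s)) g) [] 1" if "g |\<in>| G" for g
      unfolding *[symmetric] using G that by blast
    moreover have "wf_trm ((\<sigma>(v := psubst \<sigma> s)) i)" for i
      using \<sigma> substitution(5) by (simp add: wf_psubst)
    ultimately show "eval (psubst (\<sigma>(v := psubst \<sigma> s)) c) [] 1"
      using sound_P[OF substitution(2)] unfolding sound.simps by blast
  qed
next
  case (true_I G a)
  show ?thesis
    unfolding true_I(1)
    by (rule sound_mono[OF sound_P[OF true_I(2)]])
      (auto simp: eval_Eq_iff intro: eval_num)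
next
  case (true_E G a)
  show ?thesis
    unfolding true_E(1)
    by (rule sound_mono[OF sound_P[OF true_E(2)]])
      (auto simp: eval_Eq_iff dest: eval_unique[OF eval_num] split: if_splits)
next
  case (false_I G a)
  show ?thesis
    unfolding false_I(1)
    by (rule sound_mono[OF sound_P[OF false_I(2)]])
      (auto simp: eval_iffs split: if_splits)
next
  case (false_E G a)
  show ?thesis
    unfolding false_E(1)
    by (rule sound_mono[OF sound_P[OF false_E(2)]])
      (auto simp: eval_iffs split: if_splits)
next
  case (neg_E G a c)
  show ?thesis
    unfolding neg_E(1)
    by (rule sound_mono2[OF sound_P[OF neg_E(2)] sound_P[OF neg_E(3)]])
      (simp add: eval_iffs eval_not_both)
next
  case (neg_neg_I G a)
  show ?thesis
    unfolding neg_neg_I(1)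
    by (rule sound_mono[OF sound_P[OF neg_neg_I(2)]])
      (auto simp: eval_iffs split: if_splits)
next
  case (neg_neg_E G a)
  show ?thesis
    unfolding neg_neg_E(1)
    by (rule sound_mono[OF sound_P[OF neg_neg_E(2)]])
      (auto simp: eval_iffs split: if_splits)
next
  case (or_I1 G a b)
  show ?thesis
    unfolding or_I1(1)
    by (rule sound_mono[OF sound_P[OF or_I1(2)]])
      (use or_I1(3) in \<open>simp add: eval_iffs wf_psubst\<close>)
next
  case (or_I2 G b a)
  show ?thesis
    unfolding or_I2(1)
    by (rule sound_mono[OF sound_P[OF or_I2(2)]])
      (use or_I2(3) in \<open>simp add: eval_iffs wf_psubst\<close>)
next
  case (neg_or_I G a b)
  show ?thesis
    unfolding neg_or_I(1)
    by (rule sound_mono2[OF sound_P[OF neg_or_I(2)] sound_P[OF neg_or_I(3)]])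
      (auto simp: eval_iffs split: if_splits)
next
  case (or_E G a b c)
  then show ?thesis using sound_P[OF or_E(2)] sound_P[OF or_E(3)] sound_P[OF or_E(4)]
    by (simp add: eval_iffs) blast
next
  case (neg_or_E1 G a b)
  show ?thesis
    unfolding neg_or_E1(1)
    by (rule sound_mono[OF sound_P[OF neg_or_E1(2)]])
      (auto simp: eval_iffs split: if_splits)
next
  case (neg_or_E2 G a b)
  show ?thesis
    unfolding neg_or_E2(1)
    by (rule sound_mono[OF sound_P[OF neg_or_E2(2)]])
      (auto simp: eval_iffs split: if_splits)
next
  case (nat_E G a)
  show ?thesis
    unfolding nat_E(1)
    by (rule sound_mono[OF sound_P[OF nat_E(2)]])
      (auto simp: eval_iffs split: if_splits)
next
  case (nat_I G a)
  show ?thesis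
    unfolding nat_I(1)
    by (rule sound_mono[OF sound_P[OF nat_I(2)]])
      (auto simp: eval_iffs split: if_splits)
next
  case (eq_sym G a b)
  show ?thesis
    unfolding eq_sym(1)
    by (rule sound_mono[OF sound_P[OF eq_sym(2)]])
      (auto simp: eval_iffs split: if_splits)
next
  case (eq_subst G a b v p)
  show ?thesis
    unfolding eq_subst(1)
  proof (rule sound_mono2[OF sound_P[OF eq_subst(2)] sound_P[OF eq_subst(3)]])
    fix \<sigma>
    assume ab: "eval (psubst \<sigma> (a \<doteq> b)) [] 1" and p: "eval (psubst \<sigma> (subst v a p)) [] 1"
    obtain k where "eval (psubst \<sigma> a) [] k" "eval (psubst \<sigma> b) [] k"
      using ab by (auto simp: eval_Eq_iff split: if_splits)
    with p show "eval (psubst \<sigma> (subst v b p)) [] 1"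
      unfolding psubst_subst using eval_cong by blast
  qed
next
  case (neq_sym G a b)
  show ?thesis
    unfolding neq_sym(1)
    by (rule sound_mono[OF sound_P[OF neq_sym(2)]])
      (simp add: eval_Neg_iff eval_Eq_commute)
next
  case (eq_bool_I G a b)
  show ?thesis
    unfolding eq_bool_I(1)
    by (rule sound_mono2[OF sound_P[OF eq_bool_I(2)] sound_P[OF eq_bool_I(3)]])
      (auto simp: eval_Eq_iff[of _ _ 1] intro!: eval_eq_bool)
next
  case (eq_bool_E G a b)
  show ?thesis
    unfolding eq_bool_E(1)
    by (rule sound_mono[OF sound_P[OF eq_bool_E(2)]])
      (auto simp: eval_iffs split: if_splits)
next
  case (zero_nat G)
  then show ?thesis by (simp add: eval_iffs)
next
  case (suc_nat_I G a)
  show ?thesis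
    unfolding suc_nat_I(1)
    by (rule sound_mono[OF sound_P[OF suc_nat_I(2)]])
      (auto simp: eval_iffs split: if_splits)
next
  case (suc_nat_E G a)
  show ?thesis
    unfolding suc_nat_E(1)
    by (rule sound_mono[OF sound_P[OF suc_nat_E(2)]])
      (auto simp: eval_iffs split: if_splits)
next
  case (suc_neq_zero G a)
  show ?thesis
    unfolding suc_neq_zero(1)
    by (rule sound_mono[OF sound_P[OF suc_neq_zero(2)]])
      (auto simp: eval_iffs split: if_splits)
next
  case (suc_neq_I G a b)
  show ?thesis
    unfolding suc_neq_I(1)
    by (rule sound_mono[OF sound_P[OF suc_neq_I(2)]])
      (auto simp: eval_iffs split: if_splits)
next
  case (suc_neq_E G a b)
  show ?thesis
    unfolding suc_neq_E(1)
    by (rule sound_mono[OF sound_P[OF suc_neq_E(2)]])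
      (auto simp: eval_iffs split: if_splits)
next
  case (suc_inj G a b)
  show ?thesis
    unfolding suc_inj(1)
    by (rule sound_mono[OF sound_P[OF suc_inj(2)]])
      (auto simp: eval_iffs split: if_splits)
next
  case (bot_E G p)
  show ?thesis
    unfolding bot_E(1)
    by (rule sound_mono[OF sound_P[OF bot_E(2)]])
      (auto simp: eval_iffs elim: eval_BotE)
next
  case (ind G i c a)
  show ?thesis
    unfolding ind(1) sound.simps
  proof (intro allI impI)
    fix \<sigma>
    assume \<sigma>: "\<forall>i. wf_trm (\<sigma> i)" and G: "\<forall>g. g |\<in>| G \<longrightarrow> eval (psubst \<sigma> g) [] 1"
    let ?c = "psubst (\<lambda>j. if j = i then Var 0 else up (\<sigma> j)) c"
    note c = psubst_subst[of \<sigma> i _ c]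
    obtain k where k: "eval (psubst \<sigma> a) [] k"
      using sound_P[OF ind(4)] \<sigma> G by (auto simp: eval_iffs split: if_splits)
    \<comment> \<open>Induction on numerals suffices: \<open>a\<close> has the value \<open>k\<close> and can be exchanged for \<open>num k\<close>.\<close>
    have "eval (beta ?c (num n)) [] 1" for n
    proof (induction n)
      case 0
      show ?case using sound_P[OF ind(2)] \<sigma> G c[of Zero] by auto
    next
      case (Suc n)
      let ?\<sigma> = "\<sigma>(i := num n)"
      have 1: "psubst ?\<sigma> c = beta ?c (num n)"
        unfolding psubst_psubst beta_psubst by (rule psubst_cong) (auto simp: psubst_case_nat_up)
      have 2: "psubst ?\<sigma> (subst i (S (Var i)) c) = beta ?c (num (Suc n))"
        unfolding subst_psubst psubst_psubst beta_psubst
        by (rule psubst_cong) (auto simp: psubst_case_nat_up)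
      have "eval (psubst ?\<sigma> g) [] 1" if "g |\<in>| G" for g
      proof -
        have "psubst ?\<sigma> g = psubst \<sigma> g"
          by (rule psubst_cong) (use ind(6) that in auto)
        then show ?thesis using G that by simp
      qed
      moreover have "eval (psubst ?\<sigma> (IsNat (Var i))) [] 1"
        using eval_num by (auto simp: eval_iffs)
      ultimately have "eval (psubst ?\<sigma> (subst i (S (Var i)) c)) [] 1"
        using sound_P[OF ind(3)] \<sigma> Suc.IH unfolding sound.simps 1[symmetric] by auto
      then show ?case unfolding 2 .
    qed
    then show "eval (psubst \<sigma> (subst i a c)) [] 1"
      unfolding c using eval_cong[OF k eval_num] by blast
  qed
next
  case (conv_I c c' G)
  show ?thesis
    unfolding conv_I(1)
    by (rule sound_mono[OF sound_P[OF conv_I(3)]])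
      (simp add: eval_head_step[OF head_step_psubst[OF conv_I(2)]])
next
  case (conv_E c c' G)
  show ?thesis
    unfolding conv_E(1)
    by (rule sound_mono[OF sound_P[OF conv_E(3)]])
      (simp add: eval_head_step[OF head_step_psubst[OF conv_E(2)]])
next
  case (conv_eq c c' G)
  show ?thesis
    unfolding conv_eq(1)
    by (rule sound_mono[OF sound_P[OF conv_eq(3)]])
      (auto simp: eval_Eq_iff eval_head_step[OF head_step_psubst[OF conv_eq(2)]])
next
  case (rec_eq G m h g)
  show ?thesis
    unfolding rec_eq(1)
  proof (rule sound_mono2[OF sound_P[OF rec_eq(2)] sound_P[OF rec_eq(3)]])
    fix \<sigma> :: "nat \<Rightarrow> trm"
    let ?m = "psubst \<sigma> m" and ?g = "psubst \<sigma> g" and ?h = "psubst \<sigma> h"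
    assume \<sigma>: "\<And>i. wf_trm (\<sigma> i)" and m: "eval (psubst \<sigma> (IsNat m)) [] 1"
      and rhs: "eval (psubst \<sigma> (IsNat (h \<cdot> m \<cdot> (Rec \<cdot> g \<cdot> h \<cdot> m)))) [] 1"
    obtain k where k: "eval ?m [] k" using m by (auto simp: eval_Eq_iff)
    obtain n where n: "eval (?h \<cdot> ?m \<cdot> (Rec \<cdot> ?g \<cdot> ?h \<cdot> ?m)) [] n"
      using rhs by (auto simp: eval_Eq_iff)
    \<comment> \<open>Evaluation continues with the numeral of the argument, the rule with the argument itself.\<close>
    then have "eval (?h \<cdot> num k \<cdot> (Rec \<cdot> ?g \<cdot> ?h \<cdot> num k)) [] n"
      using eval_cong[OF k eval_num, of "up ?h \<cdot> Var 0 \<cdot> (Rec \<cdot> up ?g \<cdot> up ?h \<cdot> Var 0)" n]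
      by simp
    then have "eval (Rec \<cdot> ?g \<cdot> ?h \<cdot> S ?m) [] n"
      unfolding eval_App_iff
      by (intro eval.Rec_Suc[OF eval.Suc[OF k]]) (use rec_eq(4) \<sigma> in \<open>auto simp: wf_psubst\<close>)
    with n show "eval (psubst \<sigma> (Rec \<cdot> g \<cdot> h \<cdot> S m \<doteq> h \<cdot> m \<cdot> (Rec \<cdot> g \<cdot> h \<cdot> m))) [] 1"
      by (auto simp: eval_Eq_iff)
  qed
next
  case (all_I G f)
  have der: "derivable (G \<turnstile> AllC \<cdot> f)"
    by (rule derivable_step[OF follows_from.all_I[OF singletonI]]) (use derivable_P[OF all_I(2)] in auto)
  show ?thesis
    unfolding all_I(1) sound.simps
  proof (intro allI impI)
    fix \<sigma>
    assume \<sigma>: "\<forall>i. wf_trm (\<sigma> i)" and G: "\<forall>g. g |\<in>| G \<longrightarrow> eval (psubst \<sigma> g) [] 1"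
    have ev: "eval (psubst \<sigma> f) [num n] 1" for n
    proof -
      have "eval (psubst (case_nat (num n) \<sigma>) (up f \<cdot> Var 0)) [] 1"
        by (rule soundD[OF sound_P[OF all_I(2)]])
          (use \<sigma> G eval_num[of n] in
            \<open>auto simp: psubst_case_nat_up eval_Eq_iff split: nat.split\<close>)
      then show ?thesis by (simp add: psubst_case_nat_up eval_App_iff)
    qed
    have "wf_trm (AllC \<cdot> f)" using eval_wf[OF ev] \<sigma> by (simp add: wf_psubst)
    moreover have "\<forall>g. g |\<in>| G \<longrightarrow> wf_trm g" using G eval_wf \<sigma> wf_psubst by metis
    ultimately have "derivable (psubst \<sigma> |`| G \<turnstile> psubst \<sigma> (AllC \<cdot> f))"
      using der \<sigma> by (intro derivable_psubst) auto
    then have "provable (psubst \<sigma> (AllC \<cdot> f))"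
      by (rule derivable_cut_all) (use G eval_true_provable in auto)
    then show "eval (psubst \<sigma> (AllC \<cdot> f)) [] 1"
      using ev by (auto simp: eval_App_iff intro: eval.All_true)
  qed
next
  case (all_E G f a)
  show ?thesis
    unfolding all_E(1)
  proof (rule sound_mono2[OF sound_P[OF all_E(2)] sound_P[OF all_E(3)]])
    fix \<sigma>
    assume f: "eval (psubst \<sigma> (AllC \<cdot> f)) [] 1" and a: "eval (psubst \<sigma> (IsNat a)) [] 1"
    obtain k where k: "eval (psubst \<sigma> a) [] k" using a by (auto simp: eval_Eq_iff)
    have "eval (psubst \<sigma> f) [num k] 1" using f by (auto simp: eval_App_iff elim: eval_AllE)
    then show "eval (psubst \<sigma> (f \<cdot> a)) [] 1" by (simp add: eval_arg_num[OF k])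
  qed
next
  case (neg_all_I G f a)
  show ?thesis
    unfolding neg_all_I(1)
  proof (rule sound_mono2[OF sound_P[OF neg_all_I(2)] sound_P[OF neg_all_I(3)]])
    fix \<sigma>
    assume f: "eval (psubst \<sigma> (Neg (f \<cdot> a))) [] 1" and a: "eval (psubst \<sigma> (IsNat a)) [] 1"
    obtain k where k: "eval (psubst \<sigma> a) [] k" using a by (auto simp: eval_Eq_iff)
    have "eval (psubst \<sigma> f) [num k] 0"
      using f eval_arg_num[OF k] by (simp add: eval_Neg_iff)
    then show "eval (psubst \<sigma> (Neg (AllC \<cdot> f))) [] 1"
      by (auto simp: eval_iffs intro: eval.All_false)
  qed
next
  case (neg_all_E G f c)
  show ?thesis
    unfolding neg_all_E(1) sound.simps
  proof (intro allI impI)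
    fix \<sigma>
    assume \<sigma>: "\<forall>i. wf_trm (\<sigma> i)" and G: "\<forall>g. g |\<in>| G \<longrightarrow> eval (psubst \<sigma> g) [] 1"
    have "eval (psubst \<sigma> (Neg (AllC \<cdot> f))) [] 1" using sound_P[OF neg_all_E(2)] \<sigma> G by auto
    then obtain n where n: "eval (psubst \<sigma> f) [num n] 0"
      by (auto simp: eval_iffs elim: eval_AllE)
    have "eval (psubst (case_nat (num n) \<sigma>) (up c)) [] 1"
      by (rule soundD[OF sound_P[OF neg_all_E(3)]])
        (use \<sigma> G n eval_num[of n] in
          \<open>auto simp: psubst_case_nat_up eval_iffs split: nat.split\<close>)
    then show "eval (psubst \<sigma> c) [] 1" by (simp add: psubst_case_nat_up)
  qed
qed

section \<open>The existence property\<close>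

theorem theorem7p2:
  fixes u :: trm
  assumes "derivable ({||} \<turnstile> Neg (AllC \<cdot> u))"
  shows "\<exists>n. derivable ({||} \<turnstile> Neg (u \<cdot> num n))"
proof -
  have "sound ({||} \<turnstile> Neg (AllC \<cdot> u))"
    using assms by (rule derivable_induct) (blast intro: follows_from_sound)
  then have "eval (psubst Var (Neg (AllC \<cdot> u))) [] 1"
    unfolding sound.simps by (rule allE[of _ Var]) auto
  then obtain n where "eval u [num n] 0"
    by (auto simp: eval_iffs elim: eval_AllE)
  then have "eval (Neg (u \<cdot> num n)) [] 1" by (simp add: eval_iffs)
  then show ?thesis using eval_true_provable by blast
qed

end
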